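(* Let $G$ be a graph. If $\Delta(G)=|V(G)|-1$, then $G\in\mathcal{G}^{\mathrm{cs}}$; that is, $\mathrm{s}(G,w)=\mathrm{cs}(G,w)$ for every weight function $w$ on $V(G)$ with positive real values.
   Context: All graphs are finite, simple, undirected and connected (except that induced subgraphs considered below may be disconnected). $\Delta(G)$ is the maximum degree of $G$. For a graph $G$ and $S\subset V(G)$, $G[S]$ is the subgraph induced by $S$ and $G-S=G[V(G)\setminus S]$. "Component" means connected component (often identified with its vertex set). A weight function $w$ on $V(G)$ is a map assigning a positive real number to each vertex; $\mathcal{W}(G)$ is the set of all weight functions on $V(G)$. For $X\subset V(G)$, $w(X)=\sum_{v\in X}w(v)$. For disjoint $A,B\subset V(G)$, $E(A,B)$ is the set of edges joining a vertex of $A$ to a vertex of $B$. A non-empty subset $S\subset V(G)$ is a weighted safe set of $(G,w)$ if for every component $C$ of $G[S]$ and every component $D$ of $G-S$, $w(C)\ge w(D)$ whenever $E(C,D)\neq\emptyset$. If moreover $G[S]$ is connected, $S$ is a connected weighted safe set. The weighted safe number is $\mathrm{s}(G,w)=\min\{w(S)\mid S$ is a weighted safe set of $(G,w)\}$, and the connected weighted safe number is $\mathrm{cs}(G,w)=\min\{w(S)\mid S$ is a connected weighted safe set of $(G,w)\}$. $\mathcal{G}^{\mathrm{cs}}$ is the family of all (connected) graphs $G$ such that $\mathrm{s}(G,w)=\mathrm{cs}(G,w)$ for every $w\in\mathcal{W}(G)$. *)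

theory Defs
  imports Complex_Main "Graph_Theory.Graph_Theory"
begin

text \<open>
  A finite simple undirected graph is a digraph satisfying the locale predicate
  \<^const>\<open>graph\<close>, i.e. a finite symmetric digraph without loops or parallel arcs; every edge is
  represented by its two opposite arcs. Connectedness is always the graph-theoretic
  \<^const>\<open>Digraph_Component.connected\<close>, which excludes the null graph; it is written qualified
  to keep it apart from the topological constant of the same name.
\<close>

text \<open>By symmetry, the number of neighbours of a vertex is its out-degree.\<close>
definition max_degree :: "('a, 'b) pre_digraph \<Rightarrow> nat" where
  "max_degree G = Max (out_degree G ` verts G)"

definition components :: "('a, 'b) pre_digraph \<Rightarrow> 'a set set" where
  "components G = verts ` {H. pre_digraph.max_subgraph G Digraph_Component.connected H}"

text \<open>
  For disjoint \<open>A\<close> and \<open>B\<close>, each edge joining \<open>A\<close> to \<open>B\<close> has exactly one arc in this set.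
\<close>
definition edges_between :: "('a, 'b) pre_digraph \<Rightarrow> 'a set \<Rightarrow> 'a set \<Rightarrow> 'b set" where
  "edges_between G A B = {e \<in> arcs G. tail G e \<in> A \<and> head G e \<in> B}"

text \<open>Values of a weight function outside the vertex set are irrelevant.\<close>
definition weight_functions :: "('a, 'b) pre_digraph \<Rightarrow> ('a \<Rightarrow> real) set" where
  "weight_functions G = {w. \<forall>v\<in>verts G. 0 < w v}"

definition weighted_safe_set :: "('a, 'b) pre_digraph \<Rightarrow> ('a \<Rightarrow> real) \<Rightarrow> 'a set \<Rightarrow> bool" where
  "weighted_safe_set G w S \<longleftrightarrow> S \<noteq> {} \<and> S \<subseteq> verts G \<and>
     (\<forall>C \<in> components (G \<restriction> S). \<forall>D \<in> components (G \<restriction> (verts G - S)).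
        edges_between G C D \<noteq> {} \<longrightarrow> sum w D \<le> sum w C)"

definition connected_weighted_safe_set ::
    "('a, 'b) pre_digraph \<Rightarrow> ('a \<Rightarrow> real) \<Rightarrow> 'a set \<Rightarrow> bool" where
  "connected_weighted_safe_set G w S \<longleftrightarrow>
     weighted_safe_set G w S \<and> Digraph_Component.connected (G \<restriction> S)"

text \<open>
  For a finite connected graph both minima range over finite non-empty sets: the full vertex
  set is always a connected weighted safe set.
\<close>
definition weighted_safe_number :: "('a, 'b) pre_digraph \<Rightarrow> ('a \<Rightarrow> real) \<Rightarrow> real" where
  "weighted_safe_number G w = Min {sum w S | S. weighted_safe_set G w S}"

definition connected_weighted_safe_number ::
    "('a, 'b) pre_digraph \<Rightarrow> ('a \<Rightarrow> real) \<Rightarrow> real" where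
  "connected_weighted_safe_number G w = Min {sum w S | S. connected_weighted_safe_set G w S}"

definition G_cs :: "('a, 'b) pre_digraph set" where
  "G_cs = {G. graph G \<and> Digraph_Component.connected G \<and>
     (\<forall>w \<in> weight_functions G. weighted_safe_number G w = connected_weighted_safe_number G w)}"

end

theory Submission
  imports Defs
begin

text \<open>
  A vertex attaining the maximum degree \<open>card (verts G) - 1\<close> is adjacent to every other vertex; call
  it \<open>u\<close>. Every induced subgraph containing \<open>u\<close> is connected. It suffices to replace an arbitrary
  safe set \<open>S\<close> by a connected safe set of no larger weight (lemma \<open>connected_safe_set_le\<close>).

  Suppose that \<open>G[S]\<close> is disconnected. Then \<open>u\<close> is not in \<open>S\<close>, so \<open>G - S\<close> is a single component, and
  each component \<open>C\<close> of \<open>G[S]\<close> is joined to it by an edge ending in \<open>u\<close>; safety gives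
  \<open>w(V - S) \<le> w(C)\<close>. Let \<open>C\<close> be the lighter of two components of \<open>G[S]\<close> and take \<open>S' = V - C\<close>: this
  trades \<open>C\<close> for \<open>V - S\<close>, so its weight does not exceed that of \<open>S\<close>. It is connected because it
  contains \<open>u\<close>, and it is safe because it contains the heavier component, which outweighs \<open>C\<close>
  and hence everything left outside.
\<close>

section \<open>Components of symmetric digraphs\<close>

lemma strongly_connected_imp_connected:
  assumes "strongly_connected H"
  shows "Digraph_Component.connected H"
proof -
  have "arcs_ends H \<subseteq> (arcs_ends H)\<^sup>s"
    by (auto simp: symcl_def)
  then show ?thesis
    using assms unfolding connected_conv strongly_connected_def reachable_def
    by (meson order_refl rtrancl_on_mono)
qed

lemma arc_mono_connected: "arc_mono Digraph_Component.connected"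
  unfolding arc_mono_def
  by (metis spanning_def subgraphE wf_digraph.connected_spanning_imp_connected)

text \<open>
  This makes the theory of strongly connected components available. The point is that a subgraph
  need not be symmetric, but a maximal connected one is induced, and induced subgraphs inherit
  symmetry.
\<close>
lemma (in sym_digraph) components_eq_sccs_verts: "components G = sccs_verts"
proof -
  have sc_iff: "strongly_connected H \<longleftrightarrow> Digraph_Component.connected H"
    if "induced_subgraph H G" for H
    using that wf_digraphI_induced wf_digraph.symmetric_connected_imp_strongly_connected
      induced_graph_imp_symmetric[OF sym_arcs] strongly_connected_imp_connected by metis
  have "max_subgraph Digraph_Component.connected H \<longleftrightarrow> max_subgraph strongly_connected H" for H
  proof
    assume H: "max_subgraph Digraph_Component.connected H"
    then have "induced_subgraph H G"
      by (rule induced_subgraphI_arc_mono[OF _ arc_mono_connected])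
    then show "max_subgraph strongly_connected H"
      using H sc_iff max_subgraph_mp[OF H strongly_connected_imp_connected] max_subgraph_prop
      by blast
  next
    assume H: "max_subgraph strongly_connected H"
    show "max_subgraph Digraph_Component.connected H"
      unfolding max_subgraph_def
    proof (intro conjI allI impI notI)
      show "subgraph H G" "Digraph_Component.connected H"
        using H by (auto simp: max_subgraph_def strongly_connected_imp_connected)
    next
      fix H' assume 1: "H' \<noteq> H \<and> subgraph H H'"
        and 2: "subgraph H' G \<and> Digraph_Component.connected H'"
      \<comment> \<open>Filling in the missing arcs of \<open>H'\<close> makes it symmetric.\<close>
      let ?K = "G \<restriction> verts H'"
      have K: "induced_subgraph ?K G" "subgraph H' ?K"
        using 2 by (auto intro: subgraph_induce_subgraphI2)
      have "Digraph_Component.connected ?K"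
        using arc_mono_connected K(2) 2 unfolding arc_mono_def by (metis induce_subgraph_verts)
      then have "strongly_connected ?K" using sc_iff K(1) by blast
      moreover have "subgraph H ?K" using 1 K(2) subgraph_trans by blast
      ultimately have "?K = H"
        using H K(1) induced_imp_subgraph unfolding max_subgraph_def by blast
      then have "subgraph H' H" "subgraph H H'" using K(2) 1 by auto
      then have "H' = H"
        by (auto simp: subgraph_def compatible_def intro!: pre_digraph.equality)
      with 1 show False by simp
    qed
  qed
  then show ?thesis
    by (simp only: components_def sccs_verts_conv sccs_altdef2)
qed

lemma (in sym_digraph) sym_digraph_induce: "S \<subseteq> verts G \<Longrightarrow> sym_digraph (G \<restriction> S)"
  by (rule induced_graph_imp_graph) auto

lemma (in sym_digraph) components_connected:
  assumes "Digraph_Component.connected G"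
  shows "components G = {verts G}"
proof -
  have "sccs = {G}"
    using assms strongly_connected_eq_iff symmetric_connected_imp_strongly_connected[OF sym_arcs]
    by blast
  then show ?thesis
    by (simp add: components_eq_sccs_verts sccs_verts_conv)
qed

lemma (in sym_digraph) components_subset: "C \<in> components G \<Longrightarrow> C \<subseteq> verts G"
  by (simp add: components_eq_sccs_verts sccs_verts_subsets)

lemma (in sym_digraph) components_nonempty: "C \<in> components G \<Longrightarrow> C \<noteq> {}"
  by (simp add: components_eq_sccs_verts sccs_verts_def)

lemma (in sym_digraph) components_disjoint:
  "C \<in> components G \<Longrightarrow> D \<in> components G \<Longrightarrow> C \<noteq> D \<Longrightarrow> C \<inter> D = {}"
  by (simp add: components_eq_sccs_verts sccs_verts_disjoint)

lemma (in sym_digraph) vertex_in_component: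
  assumes "v \<in> verts G"
  obtains C where "C \<in> components G" "v \<in> C"
  using assms scc_of_in_sccs_verts in_scc_of_self components_eq_sccs_verts by metis

lemma (in sym_digraph) disconnected_two_components:
  assumes "verts G \<noteq> {}" and "\<not> Digraph_Component.connected G"
  obtains C D where "C \<in> components G" "D \<in> components G" "C \<noteq> D"
proof -
  obtain v C where C: "v \<in> C" "C \<in> components G"
    using assms(1) vertex_in_component by blast
  have "C \<noteq> verts G"
  proof
    assume "C = verts G"
    then have "strongly_connected G"
      using C assms(1) by (intro strongly_connectedI)
        (simp_all add: components_eq_sccs_verts sccs_verts_def)
    then show False using assms(2) strongly_connected_imp_connected by blast
  qed
  then obtain x where "x \<in> verts G" "x \<notin> C" using components_subset C by blast
  then show ?thesis using vertex_in_component C that by metis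
qed

section \<open>Universal vertices\<close>

text \<open>
  Without loops and parallel arcs, the heads of the arcs leaving a vertex \<open>u\<close> are distinct and
  differ from \<open>u\<close>, so \<open>card (verts G) - 1\<close> arcs reach all other vertices.
\<close>
lemma (in digraph) universal_vertex_of_max_degree:
  assumes "verts G \<noteq> {}" and "max_degree G = card (verts G) - 1"
  obtains u where "u \<in> verts G" "\<And>v. v \<in> verts G \<Longrightarrow> v \<noteq> u \<Longrightarrow> u \<rightarrow>\<^bsub>G\<^esub> v"
proof -
  have "max_degree G \<in> out_degree G ` verts G"
    unfolding max_degree_def using assms(1) by (intro Max_in) auto
  then obtain u where u: "u \<in> verts G" "card (out_arcs G u) = card (verts G) - 1"
    using assms(2) by (auto simp: out_degree_def)
  have "inj_on (head G) (out_arcs G u)"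
    by (rule inj_onI) (auto intro: no_multi_arcs simp: arc_to_ends_def)
  then have "card (head G ` out_arcs G u) = card (verts G - {u})"
    using u by (simp add: card_image)
  moreover have "head G ` out_arcs G u \<subseteq> verts G - {u}"
    using no_loops by auto
  ultimately have "head G ` out_arcs G u = verts G - {u}"
    by (intro card_subset_eq) auto
  then have "u \<rightarrow>\<^bsub>G\<^esub> v" if "v \<in> verts G" "v \<noteq> u" for v
    
  proof -
    have "v \<in> head G ` out_arcs G u"
      using that \<open>_ = verts G - {u}\<close> by simp
    then show ?thesis by (auto simp: arcs_ends_conv)
  qed
  with u(1) show ?thesis using that by blast
qed

lemma (in sym_digraph) connected_induce_universal:
  assumes u: "u \<in> S" "S \<subseteq> verts G" "\<And>v. v \<in> verts G \<Longrightarrow> v \<noteq> u \<Longrightarrow> u \<rightarrow>\<^bsub>G\<^esub> v"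
  shows "Digraph_Component.connected (G \<restriction> S)"
proof -
  interpret GS: sym_digraph "G \<restriction> S" using u(2) by (rule sym_digraph_induce)
  have from_u: "u \<rightarrow>\<^sup>*\<^bsub>G \<restriction> S\<^esub> v" if "v \<in> S" for v
  proof (cases "v = u")
    case False
    then have "u \<rightarrow>\<^bsub>G \<restriction> S\<^esub> v" using u that by (fastforce simp: arcs_ends_conv)
    then show ?thesis by blast
  qed (use u(1) in auto)
  have "strongly_connected (G \<restriction> S)"
  proof
    fix v x assume "v \<in> verts (G \<restriction> S)" "x \<in> verts (G \<restriction> S)"
    then have "v \<rightarrow>\<^sup>*\<^bsub>G \<restriction> S\<^esub> u" "u \<rightarrow>\<^sup>*\<^bsub>G \<restriction> S\<^esub> x"
      using from_u symmetric_reachable[OF GS.sym_arcs] by auto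
    then show "v \<rightarrow>\<^sup>*\<^bsub>G \<restriction> S\<^esub> x" by (rule GS.reachable_trans)
  qed (use u(1) in auto)
  then show ?thesis by (rule strongly_connected_imp_connected)
qed

section \<open>Safe sets in the presence of a universal vertex\<close>

text \<open>
  The exchange step: a disconnected safe set \<open>S\<close> is replaced by the complement of the lighter of two
  components of \<open>G[S]\<close>. Safety of \<open>S\<close> bounds the weight gained, and the heavier component,
  which stays inside, makes the new set safe.
\<close>
lemma (in graph) connected_safe_set_le:
  assumes u: "u \<in> verts G" "\<And>v. v \<in> verts G \<Longrightarrow> v \<noteq> u \<Longrightarrow> u \<rightarrow>\<^bsub>G\<^esub> v"
    and w: "w \<in> weight_functions G"
    and S: "weighted_safe_set G w S"
  obtains T where "connected_weighted_safe_set G w T" "sum w T \<le> sum w S"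
proof (cases "Digraph_Component.connected (G \<restriction> S)")
  case True
  then show ?thesis using S that by (auto simp: connected_weighted_safe_set_def)
next
  case False
  have SV: "S \<subseteq> verts G" "S \<noteq> {}" using S by (auto simp: weighted_safe_set_def)
  have uS: "u \<notin> S" using False connected_induce_universal u SV(1) by blast
  have mono: "sum w A \<le> sum w B" if "A \<subseteq> B" "B \<subseteq> verts G" for A B
    using that w finite_subset[OF _ finite_verts] less_imp_le
    by (intro sum_mono2) (auto simp: weight_functions_def intro!: less_imp_le)
  interpret GS: sym_digraph "G \<restriction> S" using SV(1) by (rule sym_digraph_induce)
  \<comment> \<open>\<open>G - S\<close> contains \<open>u\<close>, so it is one component, and it is adjacent to every component of \<open>G[S]\<close>.\<close>
  have outside_le: "sum w (verts G - S) \<le> sum w C" if C: "C \<in> components (G \<restriction> S)" for C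
  proof -
    obtain c where c: "c \<in> C" "c \<in> S"
      using GS.components_nonempty[OF C] GS.components_subset[OF C] by auto
    then have "c \<rightarrow>\<^bsub>G\<^esub> u" using u(2) SV(1) uS graph_symmetric by blast
    then have "edges_between G C (verts G - S) \<noteq> {}"
      using c u(1) uS by (auto simp: edges_between_def arcs_ends_conv)
    moreover have "components (G \<restriction> (verts G - S)) = {verts G - S}"
    proof -
      interpret GD: sym_digraph "G \<restriction> (verts G - S)" by (rule sym_digraph_induce) auto
      have "Digraph_Component.connected (G \<restriction> (verts G - S))"
        using u uS by (intro connected_induce_universal) auto
      from GD.components_connected[OF this] show ?thesis by simp
    qed
    ultimately show ?thesis using S C by (auto simp: weighted_safe_set_def)
  qed
  obtain C C' where C: "C \<in> components (G \<restriction> S)" "C' \<in> components (G \<restriction> S)" "C \<noteq> C'"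
    and le: "sum w C \<le> sum w C'"
    using GS.disconnected_two_components[OF _ False] SV(2)
    by (metis induce_subgraph_verts nle_le)
  have sub: "C \<subseteq> S" "C' \<subseteq> S" "C \<inter> C' = {}"
    using C GS.components_subset GS.components_disjoint by auto
  define T where "T = verts G - C"
  have T: "u \<in> T" "T \<subseteq> verts G" "verts G - T = C" "C' \<subseteq> T"
    using sub SV u(1) uS by (auto simp: T_def)
  have conn: "Digraph_Component.connected (G \<restriction> T)"
    using T u by (intro connected_induce_universal)
  interpret GT: sym_digraph "G \<restriction> T" using T(2) by (rule sym_digraph_induce)
  interpret GC: sym_digraph "G \<restriction> C" using sub(1) SV(1) by (intro sym_digraph_induce) auto
  have "sum w D \<le> sum w T" if "D \<in> components (G \<restriction> C)" for D
  proof -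
    have "sum w D \<le> sum w C"
      using GC.components_subset[OF that] sub SV by (intro mono) auto
    also note le
    also have "sum w C' \<le> sum w T" using T by (intro mono)
    finally show ?thesis .
  qed
  then have "weighted_safe_set G w T"
    using T GT.components_connected[OF conn] by (auto simp: weighted_safe_set_def)
  moreover have "sum w T \<le> sum w S"
  proof -
    have fin: "finite S" using SV(1) finite_verts by (rule finite_subset)
    have "T = (verts G - S) \<union> (S - C)" using sub SV by (auto simp: T_def)
    then have "sum w T = sum w (verts G - S) + sum w (S - C)"
      using fin by (simp only:) (rule sum.union_disjoint, auto)
    also have "sum w (S - C) = sum w S - sum w C"
      using fin sub(1) by (simp add: sum_diff)
    finally show ?thesis using outside_le[OF C(1)] by simp
  qed
  ultimately show ?thesis using conn that by (auto simp: connected_weighted_safe_set_def)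
qed

lemma (in graph) connected_safe_set_verts:
  assumes "Digraph_Component.connected G"
  shows "connected_weighted_safe_set G w (verts G)"
proof -
  have "G \<restriction> verts G = G" using induce_eq_iff_induced induced_subgraph_refl by blast
  moreover have "verts G \<noteq> {}" using assms by (auto simp: connected_conv)
  moreover interpret E: sym_digraph "G \<restriction> {}" by (rule sym_digraph_induce) simp
  have "components (G \<restriction> {}) = {}"
    using E.components_subset E.components_nonempty by fastforce
  ultimately show ?thesis
    using assms by (simp add: connected_weighted_safe_set_def weighted_safe_set_def)
qed

theorem proposition1p3:
  fixes G :: "('a, 'b) pre_digraph"
  assumes "graph G" and "Digraph_Component.connected G"
    and "max_degree G = card (verts G) - 1"
  shows "G \<in> G_cs"
proof -
  interpret graph G by fact
  have "verts G \<noteq> {}" using assms(2) by (auto simp: connected_conv)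
  then obtain u where u: "u \<in> verts G" "\<And>v. v \<in> verts G \<Longrightarrow> v \<noteq> u \<Longrightarrow> u \<rightarrow>\<^bsub>G\<^esub> v"
    using universal_vertex_of_max_degree assms(3) by blast
  have "weighted_safe_number G w = connected_weighted_safe_number G w"
    if w: "w \<in> weight_functions G" for w
  proof -
    let ?A = "{sum w S | S. weighted_safe_set G w S}"
    let ?B = "{sum w S | S. connected_weighted_safe_set G w S}"
    have BA: "?B \<subseteq> ?A" by (auto simp: connected_weighted_safe_set_def)
    have "?A \<subseteq> sum w ` Pow (verts G)" by (auto simp: weighted_safe_set_def)
    then have fin: "finite ?A" "finite ?B"
      using BA finite_subset[of _ "sum w ` Pow (verts G)"] by auto
    have ne: "?B \<noteq> {}" using connected_safe_set_verts assms(2) by blast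
    have "Min ?A \<in> ?A" using fin(1) ne BA by (intro Min_in) auto
    then obtain S where S: "Min ?A = sum w S" "weighted_safe_set G w S" by auto
    then obtain T where "connected_weighted_safe_set G w T" "sum w T \<le> Min ?A"
      using connected_safe_set_le[OF u w] by metis
    then have "Min ?B \<le> Min ?A" using fin(2) by (auto intro: order_trans[OF Min_le])
    moreover have "Min ?A \<le> Min ?B" using BA ne fin(1) by (rule Min_antimono)
    ultimately show ?thesis
      by (simp add: weighted_safe_number_def connected_weighted_safe_number_def)
  qed
  then show ?thesis using assms by (simp add: G_cs_def)
qed

end
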